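(* Let $s\ge 2$ be an integer and let $d=p^r$ where $p\ge3$ is an odd prime and $r$ is a positive integer. Then there exist integers $s'=s'(s,d)$ and $d'=d'(s,d)$ with $1\le d'\le d$ such that for every positive integer $n$, $$\nu_d(f_n(s,-1))=\delta_{d'\mathbb{Z}}(n)\,\nu_d\!\left(\frac{s'n}{d'}\right).$$
   Context: For integers $s,t$, the generalized Fibonacci sequence is $f_0(s,t)=0$, $f_1(s,t)=1$, $f_n(s,t)=s f_{n-1}(s,t)+t f_{n-2}(s,t)$ for $n\ge2$. For $d=p^r$ and a nonzero rational $q$, $\nu_d(q)=\lfloor \nu_p(q)/r\rfloor$, where $\nu_p$ is the $p$-adic valuation; for a nonzero integer $N$ this is the largest $k$ with $d^k\mid N$. For a positive integer $d'$, $\delta_{d'\mathbb{Z}}(n)$ equals $1$ if $d'\mid n$ and $0$ otherwise. *)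

theory Defs
  imports Complex_Main "HOL-Computational_Algebra.Primes"
begin

fun gen_fib :: "int \<Rightarrow> int \<Rightarrow> nat \<Rightarrow> int" where
  "gen_fib s t 0 = 0"
| "gen_fib s t (Suc 0) = 1"
| "gen_fib s t (Suc (Suc n)) = s * gen_fib s t (Suc n) + t * gen_fib s t n"

text \<open>The valuations below are only meaningful at nonzero arguments; at 0 they return the
  junk value 0.\<close>

definition padic_val :: "int \<Rightarrow> rat \<Rightarrow> int" where
  "padic_val p q = int (multiplicity p (fst (quotient_of q)))
                 - int (multiplicity p (snd (quotient_of q)))"

text \<open>This is \<open>\<nu>\<^sub>d\<close> for \<open>d = p ^ r\<close>.\<close>

definition prime_power_val :: "int \<Rightarrow> nat \<Rightarrow> rat \<Rightarrow> int" where
  "prime_power_val p r q = \<lfloor>of_int (padic_val p q) / (of_nat r :: rat)\<rfloor>"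

definition delta_multiples :: "int \<Rightarrow> int \<Rightarrow> int" where
  "delta_multiples d n = (if d dvd n then 1 else 0)"

lemma prime_power_val_of_int:
  assumes "prime p" "r > 0" "N \<noteq> 0"
  shows "prime_power_val p r (of_int N) = int (multiplicity (p ^ r) N)"
proof -
  have u: "\<not> is_unit p"
    using assms by (metis not_prime_unit)
  have "multiplicity (p ^ r) N = multiplicity p N div r"
  proof (rule multiplicity_eqI)
    show "(p ^ r) ^ (multiplicity p N div r) dvd N"
      by (simp add: power_mult [symmetric] multiplicity_dvd')
    have "multiplicity p N < r * Suc (multiplicity p N div r)"
      using assms(2) by (metis dividend_less_times_div mult_Suc_right add.commute)
    thus "\<not> (p ^ r) ^ Suc (multiplicity p N div r) dvd N"
      using power_dvd_iff_le_multiplicity[of N p "r * Suc (multiplicity p N div r)"] assms u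
      by (simp only: power_mult [symmetric]) (simp add: not_le)
  qed
  moreover have "prime_power_val p r (of_int N) = int (multiplicity p N div r)"
    unfolding prime_power_val_def padic_val_def
    by (simp add: quotient_of_int floor_divide_of_nat_eq)
  ultimately show ?thesis by simp
qed

end

theory Submission
  imports Defs "HOL-Number_Theory.Cong"
begin

text \<open>
  Write \<open>f\<^sub>n\<close> for the sequence with parameters \<open>s, -1\<close> and \<open>v\<^sub>m = 2 f\<^sub>m\<^sub>+\<^sub>1 - s f\<^sub>m\<close>. Then
  \<open>f\<^sub>m\<^sub>k(s) = f\<^sub>m(s) f\<^sub>k(v\<^sub>m)\<close> and \<open>v\<^sub>m\<^sup>2 - 4 = (s\<^sup>2 - 4) f\<^sub>m\<^sup>2\<close>. If \<open>p\<close> divides \<open>f\<^sub>m\<close>, then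
  \<open>v\<^sub>m\<close> is congruent to \<open>2\<close> or \<open>-2\<close> modulo \<open>p\<^sup>2\<close>. As \<open>f\<^sub>k(2) = k\<close>, this gives
  \<open>\<nu>\<^sub>p(f\<^sub>k(v\<^sub>m)) = \<nu>\<^sub>p(k)\<close>. So one takes for \<open>d'\<close> the least positive index with \<open>d\<close> dividing
  \<open>f\<^sub>d\<^sub>'\<close>, and \<open>s' = f\<^sub>d\<^sub>'\<close>. The bound \<open>d' \<le> d\<close> reduces to the case \<open>d = p\<close>, which is a pigeonhole
  argument on the ratios \<open>f\<^sub>m\<^sub>+\<^sub>1 / f\<^sub>m\<close> modulo \<open>p\<close>.
\<close>

section \<open>Identities for the sequence and its companion\<close>

abbreviation (input) fibm :: "int \<Rightarrow> nat \<Rightarrow> int" where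
  "fibm x \<equiv> gen_fib x (- 1)"

text \<open>The Lucas sequence with the same recurrence and the values \<open>2\<close>,
  \<open>x\<close> at \<open>0\<close>, \<open>1\<close>; it equals \<open>a^m + a^(-m)\<close> when
  \<open>x = a + 1/a\<close>.\<close>

definition companion :: "int \<Rightarrow> nat \<Rightarrow> int" where
  "companion x m = 2 * fibm x (Suc m) - x * fibm x m"

lemma fibm_add_Suc: "fibm x (Suc (m + n)) = fibm x (Suc m) * fibm x (Suc n) - fibm x m * fibm x n"
proof (induction x "- 1 :: int" m rule: gen_fib.induct)
  case (3 x m)
  have "fibm x (Suc (Suc (Suc m) + n)) = x * fibm x (Suc (Suc m + n)) - fibm x (Suc (m + n))" by simp
  then show ?case
    using 3 gen_fib.simps(3)[of x "- 1" m] gen_fib.simps(3)[of x "- 1" "Suc m"] by algebra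
qed simp_all

lemma fibm_add:
  "fibm x (a + m) = fibm x a * fibm x (Suc m) + (fibm x (Suc a) - x * fibm x a) * fibm x m"
proof (induction x "- 1 :: int" m rule: gen_fib.induct)
  case (3 x m)
  have "fibm x (a + Suc (Suc m)) = x * fibm x (a + Suc m) - fibm x (a + m)" by simp
  then show ?case
    using 3 gen_fib.simps(3)[of x "- 1" m] gen_fib.simps(3)[of x "- 1" "Suc m"] by algebra
qed simp_all

text \<open>The form \<open>X^2 - x X Y + Y^2\<close> is invariant under the recurrence step
  \<open>(X, Y)\<close> to \<open>(x X - Y, X)\<close>, so it keeps its initial value.\<close>

lemma fibm_norm: "(fibm x (Suc n))\<^sup>2 - x * fibm x (Suc n) * fibm x n + (fibm x n)\<^sup>2 = 1"
proof (induction n)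
  case (Suc n)
  then show ?case by (simp add: power2_eq_square algebra_simps)
qed simp

lemma coprime_fibm_Suc: "coprime (fibm x n) (fibm x (Suc n))"
proof (rule coprimeI)
  fix c assume "c dvd fibm x n" "c dvd fibm x (Suc n)"
  then have "c dvd (fibm x (Suc n))\<^sup>2 - x * fibm x (Suc n) * fibm x n + (fibm x n)\<^sup>2"
    by (simp add: power2_eq_square)
  then show "is_unit c" by (simp only: fibm_norm)
qed

lemma companion_square: "(companion x m)\<^sup>2 - 4 = (x\<^sup>2 - 4) * (fibm x m)\<^sup>2"
  using fibm_norm[of x m] unfolding companion_def by algebra

text \<open>Terms at indices in steps of \<open>m\<close> obey the same recurrence with
  \<open>x\<close> replaced by \<open>v_m\<close>; this drives the induction for
  \<open>fibm_mult\<close>.\<close>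

lemma fibm_step: "fibm x (a + m + m) = companion x m * fibm x (a + m) - fibm x a"
proof -
  have "fibm x (a + m + m) = fibm x (a + m) * fibm x (Suc m)
      + (fibm x (Suc (a + m)) - x * fibm x (a + m)) * fibm x m"
    by (rule fibm_add)
  then show ?thesis
    using fibm_add[of x a m] fibm_add_Suc[of x a m] fibm_norm[of x m]
    unfolding companion_def by algebra
qed

lemma fibm_mult: "fibm x (m * k) = fibm x m * fibm (companion x m) k"
proof (induction x "- 1 :: int" k rule: gen_fib.induct)
  case (3 x n)
  have "m * Suc (Suc n) = m * n + m + m" "m * Suc n = m * n + m" by simp_all
  then show ?case using 3 fibm_step[of x "m * n" m] by (simp add: algebra_simps)
qed simp_all

section \<open>Dependence on the parameter and valuations at multiples of an index\<close>

lemma fibm_cong: "[x = y] (mod q) \<Longrightarrow> [fibm x n = fibm y n] (mod q)"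
proof (induction x "- 1 :: int" n rule: gen_fib.induct)
  case (3 x n)
  then have "[x * fibm x (Suc n) - fibm x n = y * fibm y (Suc n) - fibm y n] (mod q)"
    by (intro cong_diff cong_mult) auto
  then show ?case by simp
qed simp_all

lemma companion_cong: "[x = y] (mod q) \<Longrightarrow> [companion x m = companion y m] (mod q)"
  unfolding companion_def by (intro cong_diff cong_mult fibm_cong) auto

lemma fibm_two: "fibm 2 n = int n"
  by (induction "2 :: int" "- 1 :: int" n rule: gen_fib.induct) simp_all

lemma companion_two: "companion 2 m = 2"
  by (simp only: companion_def fibm_two) simp

text \<open>Reduces a parameter congruent to \<open>-2\<close> to one congruent to \<open>2\<close>;
  the sign does not affect multiplicities.\<close>

lemma fibm_uminus: "fibm (- x) n = (- 1) ^ Suc n * fibm x n"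
  by (induction x "- 1 :: int" n rule: gen_fib.induct) (simp_all add: algebra_simps)

lemma fibm_pos:
  assumes "s \<ge> 2" "n > 0"
  shows "fibm s n > 0"
proof -
  have "0 \<le> fibm s n \<and> fibm s n < fibm s (Suc n)" for n
  proof (induction n)
    case (Suc n)
    then have "2 * fibm s (Suc n) \<le> s * fibm s (Suc n)"
      using assms(1) by (intro mult_right_mono) auto
    then show ?case using Suc unfolding gen_fib.simps by linarith
  qed simp
  from this[of "n - 1"] show ?thesis using assms(2) by simp
qed

text \<open>Factors \<open>p\<close> are stripped from \<open>k\<close> one at a time by
  \<open>fibm_mult\<close>: \<open>f_p(x)\<close> is congruent to \<open>p\<close> modulo
  \<open>p^2\<close>, so it contributes exactly one, and the new parameter \<open>v_p\<close> is
  again congruent to \<open>2\<close>. Once \<open>p\<close> no longer divides \<open>k\<close>,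
  neither does it divide \<open>f_k(x)\<close>.\<close>

lemma multiplicity_fibm_cong_two:
  fixes p x :: int
  assumes "prime p" "[x = 2] (mod p\<^sup>2)" "k > 0"
  shows "fibm x k \<noteq> 0 \<and> multiplicity p (fibm x k) = multiplicity p (int k)"
  using assms(2,3)
proof (induction k arbitrary: x rule: less_induct)
  case (less k)
  have p1: "p > 1" using assms(1) prime_gt_1_int by blast
  show ?case
  proof (cases "p dvd int k")
    case False
    have "[x = 2] (mod p)"
      using less.prems(1) by (rule cong_dvd_modulus) simp
    then have "[fibm x k = int k] (mod p)"
      using fibm_cong[of x 2 p k] by (simp only: fibm_two)
    then have "\<not> p dvd fibm x k" using False cong_dvd_iff by blast
    then show ?thesis using False by (auto simp: not_dvd_imp_multiplicity_0)
  next
    case True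
    define P where "P = nat p"
    have P: "p = int P" using p1 by (simp add: P_def)
    then obtain u where u: "k = P * u" using True by auto
    have "u > 0" "u < k" using u less.prems(2) p1 P by auto
    have "[companion x P = 2] (mod p\<^sup>2)"
      using companion_cong[OF less.prems(1)] by (metis companion_two)
    then have IH: "fibm (companion x P) u \<noteq> 0"
        "multiplicity p (fibm (companion x P) u) = multiplicity p (int u)"
      using less.IH \<open>u > 0\<close> \<open>u < k\<close> by blast+
    have c: "[fibm x P = p] (mod p\<^sup>2)"
      using fibm_cong[OF less.prems(1)] P by (metis fibm_two)
    have d1: "p ^ 1 dvd fibm x P"
      using cong_dvd_modulus[OF c, of p] cong_dvd_iff by fastforce
    have d2: "\<not> p ^ Suc 1 dvd fibm x P"
    proof
      assume "p ^ Suc 1 dvd fibm x P"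
      then have "p\<^sup>2 dvd p" using cong_dvd_iff[OF c] by (simp add: power2_eq_square)
      then have "p\<^sup>2 \<le> p" using p1 by (intro zdvd_imp_le) auto
      then show False using p1 by (simp add: power2_eq_square)
    qed
    have m1: "multiplicity p (fibm x P) = 1" using d1 d2 by (rule multiplicity_eqI)
    have nz: "fibm x P \<noteq> 0" using d2 by auto
    have "multiplicity p (fibm x k) = 1 + multiplicity p (int u)"
      unfolding u fibm_mult using assms(1) nz IH m1
      by (simp add: prime_elem_multiplicity_mult_distrib[OF prime_imp_prime_elem])
    moreover have "multiplicity p (int k) = 1 + multiplicity p (int u)"
      using assms(1) \<open>u > 0\<close> p1 unfolding u of_nat_mult P[symmetric]
      by (subst prime_elem_multiplicity_mult_distrib) auto
    moreover have "fibm x k \<noteq> 0" unfolding u fibm_mult using nz IH by simp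
    ultimately show ?thesis by simp
  qed
qed

lemma multiplicity_fibm_mult:
  fixes p s :: int
  assumes "prime p" "odd p" "p dvd fibm s m" "fibm s m \<noteq> 0" "k > 0"
  shows "multiplicity p (fibm s (m * k)) = multiplicity p (fibm s m) + multiplicity p (int k)"
proof -
  define x where "x = companion s m"
  have "p\<^sup>2 dvd (s\<^sup>2 - 4) * (fibm s m)\<^sup>2"
    using assms(3) by (simp add: dvd_power_same)
  then have d: "p\<^sup>2 dvd (x - 2) * (x + 2)"
    unfolding companion_square[of s m, symmetric] x_def[symmetric]
    by (simp add: power2_eq_square algebra_simps)
  \<comment> \<open>An odd \<open>p\<close> cannot divide both factors, as their difference is
    \<open>4\<close>; hence \<open>p^2\<close> divides one of them entirely.\<close>
  have "\<not> (p dvd x - 2 \<and> p dvd x + 2)"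
  proof
    assume "p dvd x - 2 \<and> p dvd x + 2"
    then have "p dvd (x + 2) - (x - 2)" using dvd_diff by blast
    then have "p dvd 2 ^ 2" by simp
    then have "p dvd 2" using assms(1) prime_dvd_power by blast
    then have "p = 2" using assms(1) by (simp add: primes_dvd_imp_eq)
    then show False using assms(2) by simp
  qed
  then have "coprime (p\<^sup>2) (x - 2) \<or> coprime (p\<^sup>2) (x + 2)"
    using assms(1) prime_imp_coprime by (metis coprime_power_left_iff)
  then have "p\<^sup>2 dvd x + 2 \<or> p\<^sup>2 dvd x - 2"
    using d by (auto simp: coprime_dvd_mult_right_iff coprime_dvd_mult_left_iff)
  then have "[x = 2] (mod p\<^sup>2) \<or> [- x = 2] (mod p\<^sup>2)"
  proof
    assume "p\<^sup>2 dvd x + 2"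
    then have "p\<^sup>2 dvd - (x + 2)" by (simp only: dvd_minus_iff)
    then show ?thesis by (simp add: cong_iff_dvd_diff)
  qed (simp add: cong_iff_dvd_diff)
  then have "fibm x k \<noteq> 0 \<and> multiplicity p (fibm x k) = multiplicity p (int k)"
  proof
    assume "[- x = 2] (mod p\<^sup>2)"
    from multiplicity_fibm_cong_two[OF assms(1) this assms(5)]
    show ?thesis
      by (cases "even k") (simp_all add: fibm_uminus multiplicity_cong[of p "- fibm x k" "fibm x k"])
  qed (use multiplicity_fibm_cong_two assms in blast)
  then show ?thesis
    using assms by (simp add: fibm_mult x_def prime_elem_multiplicity_mult_distrib[OF prime_imp_prime_elem])
qed

section \<open>Rank of apparition\<close>

text \<open>Modulo \<open>q\<close>, \<open>f_(n+m)\<close> is \<open>f_n\<close> times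
  \<open>f_(m+1)\<close>, and the latter is coprime to \<open>q\<close>.\<close>

lemma dvd_fibm_add_iff:
  assumes "q dvd fibm s m"
  shows "q dvd fibm s (n + m) \<longleftrightarrow> q dvd fibm s n"
proof -
  have "coprime q (fibm s (Suc m))"
    using assms coprime_fibm_Suc by (rule coprime_divisors[OF _ dvd_refl])
  moreover have "q dvd (fibm s (Suc n) - s * fibm s n) * fibm s m" using assms by simp
  ultimately show ?thesis
    unfolding fibm_add by (simp add: dvd_add_left_iff coprime_dvd_mult_left_iff)
qed

text \<open>Shifts by \<open>m\<close> reduce \<open>n\<close> to \<open>n mod m\<close>, which must
  be \<open>0\<close> by minimality of \<open>m\<close>.\<close>

lemma dvd_fibm_iff_rank_dvd:
  assumes "q dvd fibm s m" "m > 0" "\<And>j. 0 < j \<Longrightarrow> j < m \<Longrightarrow> \<not> q dvd fibm s j"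
  shows "q dvd fibm s n \<longleftrightarrow> m dvd n"
proof -
  have "q dvd fibm s (n mod m + m * i) \<longleftrightarrow> q dvd fibm s (n mod m)" for i
  proof (induction i)
    case (Suc i)
    have "n mod m + m * Suc i = (n mod m + m * i) + m" by simp
    then show ?case using Suc dvd_fibm_add_iff[OF assms(1)] by metis
  qed simp
  from this[of "n div m"] have "q dvd fibm s n \<longleftrightarrow> q dvd fibm s (n mod m)" by simp
  also have "\<dots> \<longleftrightarrow> n mod m = 0"
    using assms(2) assms(3)[of "n mod m"] by (cases "n mod m = 0") auto
  finally show ?thesis by (simp add: dvd_eq_mod_eq_0)
qed

section \<open>Bounding the rank by pigeonhole\<close>

text \<open>If the ratios of successive terms at \<open>n\<close> and \<open>n + j\<close> agree
  modulo \<open>p\<close>, then \<open>p\<close> divides \<open>f_j\<close>.\<close>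

lemma fibm_cross: "fibm s (Suc (n + j)) * fibm s n - fibm s (n + j) * fibm s (Suc n) = - fibm s j"
  using fibm_add_Suc[of s n j] fibm_add[of s n j] fibm_norm[of s n] by algebra

text \<open>Under \<open>nd\<close> the \<open>p\<close> ratios exist modulo \<open>p\<close> and
  are pairwise distinct by \<open>fibm_cross\<close>, so they fill all residue classes.\<close>

lemma fibm_ratio_surj:
  fixes p s :: int
  assumes "prime p" and nd: "\<And>m. 1 \<le> m \<Longrightarrow> int m \<le> p \<Longrightarrow> \<not> p dvd fibm s m"
  shows "\<exists>m\<ge>1. int m \<le> p \<and> [fibm s (Suc m) = c * fibm s m] (mod p)"
proof -
  define M where "M = {1..nat p}"
  have p0: "p > 0" using assms(1) prime_gt_0_int by blast
  have M: "m \<in> M \<longleftrightarrow> 1 \<le> m \<and> int m \<le> p" for m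
    using p0 by (auto simp: M_def le_nat_iff)
  have "\<exists>g. [fibm s m * g = 1] (mod p)" if "m \<in> M" for m
  proof -
    have "coprime p (fibm s m)" using nd that M assms(1) prime_imp_coprime by blast
    then show ?thesis using cong_solve_coprime_int[of "fibm s m" p] by (simp add: coprime_commute)
  qed
  then obtain g where g: "\<And>m. m \<in> M \<Longrightarrow> [fibm s m * g m = 1] (mod p)" by metis
  \<comment> \<open>\<open>g m\<close> inverts \<open>f_m\<close> modulo \<open>p\<close>, so
    \<open>h m\<close> is the ratio as a residue in \<open>{0..<p}\<close>.\<close>
  define h where "h m = (fibm s (Suc m) * g m) mod p" for m
  have h: "[fibm s (Suc m) = h m * fibm s m] (mod p)" if "m \<in> M" for m
  proof -
    have "[h m * fibm s m = (fibm s (Suc m) * g m) * fibm s m] (mod p)"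
      unfolding h_def by (intro cong_mult) auto
    also have "(fibm s (Suc m) * g m) * fibm s m = fibm s (Suc m) * (fibm s m * g m)" by simp
    also have "[\<dots> = fibm s (Suc m) * 1] (mod p)" using g[OF that] by (intro cong_mult) auto
    finally show ?thesis by (simp add: cong_sym)
  qed
  have ne: "h m \<noteq> h n" if "m \<in> M" "n \<in> M" "n < m" for m n
  proof
    assume e: "h m = h n"
    obtain j where j: "m = n + j" using \<open>n < m\<close> less_imp_add_positive by blast
    have "[fibm s (Suc m) * fibm s n - fibm s m * fibm s (Suc n)
        = (h m * fibm s m) * fibm s n - fibm s m * (h n * fibm s n)] (mod p)"
      using h that by (intro cong_diff cong_mult) auto
    then have "[- fibm s j = 0] (mod p)"
      unfolding e unfolding j fibm_cross by (simp add: algebra_simps)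
    then have "p dvd fibm s j" by (simp add: cong_0_iff)
    moreover have "1 \<le> j" "int j \<le> p" using that j M by auto
    ultimately show False using nd by blast
  qed
  then have "inj_on h M" by (intro inj_onI) (metis linorder_neqE_nat)
  then have "card (h ` M) = card {0..<p}" by (simp add: card_image M_def)
  moreover have "h ` M \<subseteq> {0..<p}" using p0 by (auto simp: h_def)
  ultimately have "h ` M = {0..<p}" by (intro card_subset_eq) auto
  moreover have "c mod p \<in> {0..<p}" using p0 by auto
  ultimately obtain m where m: "m \<in> M" "h m = c mod p" by (metis imageE)
  have "[h m * fibm s m = c * fibm s m] (mod p)"
    unfolding m(2) by (intro cong_mult) auto
  then show ?thesis using h[OF m(1)] m(1) M cong_trans by blast
qed

text \<open>Pigeonhole alone gives \<open>m \<le> p + 1\<close>. If \<open>p + 1\<close> were the least such index, the ratio \<open>1\<close> would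
  occur, and then \<open>p\<close> would divide \<open>f\<^sub>2\<^sub>m\<^sub>+\<^sub>1 = f\<^sub>m\<^sub>+\<^sub>1\<^sup>2 - f\<^sub>m\<^sup>2\<close> for some \<open>m\<close>, although \<open>p + 1\<close> is even.\<close>

lemma prime_dvd_fibm_le:
  fixes p s :: int
  assumes "prime p" "odd p"
  shows "\<exists>m\<ge>1. int m \<le> p \<and> p dvd fibm s m"
proof (rule ccontr)
  assume "\<not> ?thesis"
  then have nd: "\<not> p dvd fibm s m" if "1 \<le> m" "int m \<le> p" for m using that by blast
  obtain a where a: "a \<ge> 1" "int a \<le> p" "[fibm s (Suc a) = 0 * fibm s a] (mod p)"
    using fibm_ratio_surj[OF assms(1), of s 0] nd by blast
  have da: "p dvd fibm s (Suc a)" using a(3) by (simp add: cong_0_iff)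
  \<comment> \<open>The multiple of \<open>p\<close> at index \<open>a + 1\<close> lies outside the
    excluded range, which forces \<open>a = p\<close>.\<close>
  then have ap: "int a = p" using nd[of "Suc a"] a by force
  obtain m where m: "m \<ge> 1" "int m \<le> p" "[fibm s (Suc m) = 1 * fibm s m] (mod p)"
    using fibm_ratio_surj[OF assms(1), of s 1] nd by blast
  have "fibm s (Suc (m + m)) = (fibm s (Suc m) - fibm s m) * (fibm s (Suc m) + fibm s m)"
    unfolding fibm_add_Suc by (simp add: algebra_simps)
  moreover have "p dvd fibm s (Suc m) - fibm s m" using m(3) by (simp add: cong_iff_dvd_diff)
  ultimately have dm: "p dvd fibm s (Suc (m + m))" by (metis dvd_mult2)
  have "odd a" using ap assms(2) by auto
  show False
  proof (cases "m + m < a")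
    case True
    then show False using nd[of "Suc (m + m)"] dm ap by simp
  next
    case False
    moreover have "m + m \<noteq> a" using \<open>odd a\<close> by auto
    ultimately obtain j where j: "m + m = j + a" "1 \<le> j"
      using less_imp_add_positive[of a "m + m"]
      by (metis Suc_leI One_nat_def add.commute linorder_neqE_nat)
    \<comment> \<open>Shifting the index \<open>2m + 1\<close> back by \<open>a + 1\<close> leaves
      \<open>j = 2m - p\<close>, which is at most \<open>p\<close>.\<close>
    then have "p dvd fibm s (j + Suc a)" using dm by simp
    then have "p dvd fibm s j" using dvd_fibm_add_iff[OF da] by blast
    moreover have "int j \<le> p" using j m ap by linarith
    ultimately show False using nd j by blast
  qed
qed

text \<open>Multiplying an index that works for \<open>p\<close> by \<open>p^(r-1)\<close> raises
  the valuation from at least \<open>1\<close> to at least \<open>r\<close>.\<close>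

lemma prime_power_dvd_fibm_le:
  fixes p s :: int
  assumes "prime p" "odd p" "s \<ge> 2" "r > 0"
  shows "\<exists>m>0. int m \<le> p ^ r \<and> p ^ r dvd fibm s m"
proof -
  obtain m where m: "m \<ge> 1" "int m \<le> p" "p dvd fibm s m"
    using prime_dvd_fibm_le assms by blast
  have p1: "p > 1" using assms(1) prime_gt_1_int by blast
  define k where "k = nat p ^ (r - 1)"
  have k: "int k = p ^ (r - 1)" "k > 0" using p1 by (simp_all add: k_def)
  have nz: "fibm s m \<noteq> 0" using fibm_pos[of s m] assms(3) m(1) by simp
  have "multiplicity p (fibm s m) \<ge> 1"
    using m(3) nz p1 by (intro multiplicity_geI) auto
  moreover have "multiplicity p (int k) = r - 1"
    using assms(1) p1 by (simp add: k(1) multiplicity_same_power)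
  ultimately have "multiplicity p (fibm s (m * k)) \<ge> r"
    using multiplicity_fibm_mult[OF assms(1,2) m(3) nz k(2)] by simp
  then have "p ^ r dvd fibm s (m * k)" by (rule multiplicity_dvd')
  moreover have "int (m * k) \<le> p ^ r"
  proof -
    have "int m * int k \<le> p * p ^ (r - 1)"
      unfolding k(1) using m(2) p1 by (intro mult_right_mono) auto
    also have "\<dots> = p ^ r" using assms(4) by (simp add: power_eq_if)
    finally show ?thesis by simp
  qed
  ultimately show ?thesis using m(1) k(2) by (intro exI[of _ "m * k"]) auto
qed

theorem theorem13:
  fixes s p d :: int and r :: nat
  assumes "s \<ge> 2"
    and "prime p" and "odd p" and "p \<ge> 3"
    and "r > 0"
    and "d = p ^ r"
  shows "\<exists>s' d' :: int. s' \<noteq> 0 \<and> 1 \<le> d' \<and> d' \<le> d \<and>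
    (\<forall>n::nat. n > 0 \<longrightarrow>
      prime_power_val p r (of_int (gen_fib s (-1) n)) =
      delta_multiples d' (int n) * prime_power_val p r (of_int s' * of_nat n / of_int d'))"
proof -
  define Q where "Q m \<longleftrightarrow> m > 0 \<and> d dvd fibm s m" for m
  define e where "e = (LEAST m. Q m)"
  obtain m where m: "Q m" "int m \<le> d"
    using prime_power_dvd_fibm_le assms unfolding Q_def by blast
  have e: "e > 0" "d dvd fibm s e" using LeastI[of Q, OF m(1)] by (auto simp: e_def Q_def)
  have ed: "int e \<le> d" using Least_le[of Q, OF m(1)] m(2) by (simp add: e_def)
  have min: "\<not> d dvd fibm s j" if "0 < j" "j < e" for j
    using not_less_Least[of j Q] that by (auto simp: e_def Q_def)
  have rank: "d dvd fibm s n \<longleftrightarrow> e dvd n" for n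
    using e min by (intro dvd_fibm_iff_rank_dvd) auto
  have nz: "fibm s n \<noteq> 0" if "n > 0" for n using fibm_pos[OF assms(1) that] by simp
  have pe: "p dvd fibm s e" using e(2) assms(5,6) by (metis dvd_power dvd_trans)
  have "prime_power_val p r (of_int (fibm s n)) =
      delta_multiples (int e) (int n) * prime_power_val p r (of_int (fibm s e) * of_nat n / of_int (int e))"
    if n: "n > 0" for n
  proof (cases "e dvd n")
    case True
    then obtain k where k: "n = e * k" by blast
    then have k0: "k > 0" using n by simp
    have "multiplicity p (fibm s n) = multiplicity p (fibm s e * int k)"
      unfolding k multiplicity_fibm_mult[OF assms(2,3) pe nz[OF e(1)] k0]
      using assms(2) nz[OF e(1)] k0 by (simp add: prime_elem_multiplicity_mult_distrib[OF prime_imp_prime_elem])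
    then have "prime_power_val p r (of_int (fibm s n)) = prime_power_val p r (of_int (fibm s e * int k))"
      by (simp add: prime_power_val_def padic_val_def quotient_of_int del: of_int_mult)
    \<comment> \<open>The argument \<open>s' n / d'\<close> is the integer \<open>f_e k\<close>,
      which has the same valuation at \<open>p\<close> as \<open>f_n\<close>.\<close>
    moreover have "(of_int (fibm s e) * of_nat n / of_int (int e) :: rat) = of_int (fibm s e * int k)"
      using e(1) by (simp add: k)
    ultimately show ?thesis using True by (simp add: delta_multiples_def)
  next
    case False
    \<comment> \<open>Here \<open>p\<close> may still divide \<open>f_n\<close>, but fewer than
      \<open>r\<close> times, so the floor is \<open>0\<close>.\<close>
    then have "multiplicity d (fibm s n) = 0" using rank by (simp add: not_dvd_imp_multiplicity_0)
    then have "prime_power_val p r (of_int (fibm s n)) = 0"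
      using prime_power_val_of_int[OF assms(2,5) nz[OF n]] assms(6) by simp
    then show ?thesis using False by (simp add: delta_multiples_def)
  qed
  then show ?thesis using nz[OF e(1)] e(1) ed
    by (intro exI[of _ "fibm s e"] exI[of _ "int e"]) auto
qed

end
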